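(* If $M$ is a $3$-pseudomanifold with exactly $8$ vertices, then there exists a sequence of bistellar $1$-moves $\kappa_{A_1},\dots,\kappa_{A_m}$, for some $m\ge 0$, such that $\kappa_{A_m}(\cdots(\kappa_{A_1}(M)))$ is a neighbourly $3$-pseudomanifold.
   Context: All simplicial complexes are finite. A simplicial complex is a collection of non-empty finite sets closed under taking non-empty subsets; an element of size $i+1$ is an $i$-face (or $i$-simplex), and $0$-faces are identified with vertices. A $d$-dimensional complex $K$ is pure if every face is contained in a $d$-face; its $d$-faces are then called facets. A $d$-dimensional pure complex is a weak $d$-pseudomanifold if each $(d-1)$-face is in exactly two facets. It is a $d$-pseudomanifold if moreover the graph whose vertices are the facets, two facets being adjacent when they intersect in a $(d-1)$-face, is connected. A complex is neighbourly if every pair of its vertices forms an edge. The link of a face $\sigma$ in $K$ is $\mathrm{lk}_K(\sigma)=\{\tau\in K:\tau\cap\sigma=\emptyset,\ \tau\cup\sigma\in K\}$. Bistellar $1$-move on a weak $3$-pseudomanifold $M$: let $A$ be a $2$-face of $M$ whose link consists of two vertices $x,y$ such that $\{x,y\}$ is not an edge of $M$. Then $\kappa_A(M)$ is the weak $3$-pseudomanifold whose set of facets is $\{\sigma:\sigma\text{ a facet of }M,\ A\not\subseteq\sigma\}\cup\{\{x,y\}\cup A\setminus\{v\}: v\in A\}$. The operation $\kappa_A: M\mapsto\kappa_A(M)$ is called a bistellar $1$-move. In the sequence each $\kappa_{A_{i}}$ is a bistellar $1$-move applied to $\kappa_{A_{i-1}}(\cdots(\kappa_{A_1}(M)))$.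 *)

theory Defs
  imports Main
begin

definition simplicial_complex :: "'a set set \<Rightarrow> bool" where
  "simplicial_complex K \<longleftrightarrow>
     finite K \<and> (\<forall>\<sigma>\<in>K. finite \<sigma> \<and> \<sigma> \<noteq> {}) \<and>
     (\<forall>\<sigma>\<in>K. \<forall>\<tau>. \<tau> \<subseteq> \<sigma> \<and> \<tau> \<noteq> {} \<longrightarrow> \<tau> \<in> K)"

definition faces :: "nat \<Rightarrow> 'a set set \<Rightarrow> 'a set set" where
  "faces i K = {\<sigma> \<in> K. card \<sigma> = i + 1}"

definition vertices :: "'a set set \<Rightarrow> 'a set" where
  "vertices K = {v. {v} \<in> K}"

definition link :: "'a set set \<Rightarrow> 'a set \<Rightarrow> 'a set set" where
  "link K \<sigma> = {\<tau> \<in> K. \<tau> \<inter> \<sigma> = {} \<and> \<tau> \<union> \<sigma> \<in> K}"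

definition has_dimension :: "nat \<Rightarrow> 'a set set \<Rightarrow> bool" where
  "has_dimension d K \<longleftrightarrow> (\<forall>\<sigma>\<in>K. card \<sigma> \<le> d + 1) \<and> faces d K \<noteq> {}"

definition pure_complex :: "nat \<Rightarrow> 'a set set \<Rightarrow> bool" where
  "pure_complex d K \<longleftrightarrow>
     simplicial_complex K \<and> has_dimension d K \<and> (\<forall>\<sigma>\<in>K. \<exists>\<tau>\<in>faces d K. \<sigma> \<subseteq> \<tau>)"

text \<open>Dimension 0 is excluded, so that the truncated subtraction below is harmless.\<close>

definition weak_pseudomanifold :: "nat \<Rightarrow> 'a set set \<Rightarrow> bool" where
  "weak_pseudomanifold d K \<longleftrightarrow>
     d \<ge> 1 \<and> pure_complex d K \<and>
     (\<forall>\<tau>\<in>faces (d - 1) K. card {\<sigma> \<in> faces d K. \<tau> \<subseteq> \<sigma>} = 2)"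

definition facet_graph :: "nat \<Rightarrow> 'a set set \<Rightarrow> ('a set \<times> 'a set) set" where
  "facet_graph d K =
     {(\<sigma>, \<tau>). \<sigma> \<in> faces d K \<and> \<tau> \<in> faces d K \<and> \<sigma> \<inter> \<tau> \<in> faces (d - 1) K}"

definition pseudomanifold :: "nat \<Rightarrow> 'a set set \<Rightarrow> bool" where
  "pseudomanifold d K \<longleftrightarrow>
     weak_pseudomanifold d K \<and>
     (\<forall>\<sigma>\<in>faces d K. \<forall>\<tau>\<in>faces d K. (\<sigma>, \<tau>) \<in> (facet_graph d K)\<^sup>*)"

definition neighbourly :: "'a set set \<Rightarrow> bool" where
  "neighbourly K \<longleftrightarrow> (\<forall>x\<in>vertices K. \<forall>y\<in>vertices K. x \<noteq> y \<longrightarrow> {x, y} \<in> K)"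

definition complex_of_facets :: "'a set set \<Rightarrow> 'a set set" where
  "complex_of_facets F = {\<tau>. \<tau> \<noteq> {} \<and> (\<exists>\<sigma>\<in>F. \<tau> \<subseteq> \<sigma>)}"

definition bistellar1_admissible :: "'a set \<Rightarrow> 'a set set \<Rightarrow> bool" where
  "bistellar1_admissible A M \<longleftrightarrow>
     A \<in> faces 2 M \<and> (\<exists>x y. x \<noteq> y \<and> link M A = {{x}, {y}} \<and> {x, y} \<notin> M)"

text \<open>If the link of \<open>A\<close> consists of the vertices \<open>x\<close> and \<open>y\<close>,
  then \<open>\<Union>(link M A)\<close> is the set \<open>{x, y}\<close>.\<close>

definition kappa :: "'a set \<Rightarrow> 'a set set \<Rightarrow> 'a set set" where
  "kappa A M = complex_of_facets
     ({\<sigma> \<in> faces 3 M. \<not> A \<subseteq> \<sigma>} \<union> {\<Union>(link M A) \<union> (A - {v}) | v. v \<in> A})"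

fun bistellar1_sequence :: "'a set list \<Rightarrow> 'a set set \<Rightarrow> bool" where
  "bistellar1_sequence [] M \<longleftrightarrow> True"
| "bistellar1_sequence (A # As) M \<longleftrightarrow>
     bistellar1_admissible A M \<and> bistellar1_sequence As (kappa A M)"

end

theory Submission
  imports Defs
begin

text \<open>
A bistellar 1-move on a 3-pseudomanifold with eight vertices gives another one with one more edge
on the same vertices, so it suffices to show that a move exists as long as some pair \<open>x, y\<close> is not
an edge. Suppose that no move exists and let \<open>V\<close> be the set of the six other vertices. Two facets
\<open>T \<union> {p}\<close>, \<open>T \<union> {q}\<close> on a common triangle \<open>T\<close> then always satisfy \<open>pq \<in> M\<close>. A finite
case analysis on the tetrahedra of \<open>V\<close> and the links of \<open>x\<close> and \<open>y\<close> shows that no facet inside \<open>V\<close>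
has a triangle in each of the two links, and that a facet inside \<open>V\<close> adjacent to one with a triangle
in the link of \<open>x\<close> has such a triangle itself. Hence the facets in or next to the star of \<open>x\<close> are
closed under adjacency and never contain \<open>y\<close>, against strong connectedness.
\<close>

section \<open>Bistellar 1-moves\<close>

lemma pseudomanifoldD:
  assumes "pseudomanifold 3 M"
  shows "finite M" "\<And>\<sigma>. \<sigma> \<in> M \<Longrightarrow> finite \<sigma>" "{} \<notin> M"
    "\<And>\<sigma> \<tau>. \<sigma> \<in> M \<Longrightarrow> \<tau> \<subseteq> \<sigma> \<Longrightarrow> \<tau> \<noteq> {} \<Longrightarrow> \<tau> \<in> M"
    "\<And>\<sigma>. \<sigma> \<in> M \<Longrightarrow> card \<sigma> \<le> 4"
    "\<And>\<sigma>. \<sigma> \<in> M \<Longrightarrow> \<exists>\<tau>\<in>faces 3 M. \<sigma> \<subseteq> \<tau>"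
    "\<And>\<tau>. \<tau> \<in> faces 2 M \<Longrightarrow> card {\<sigma> \<in> faces 3 M. \<tau> \<subseteq> \<sigma>} = 2"
    "\<And>\<sigma> \<tau>. \<sigma> \<in> faces 3 M \<Longrightarrow> \<tau> \<in> faces 3 M \<Longrightarrow> (\<sigma>, \<tau>) \<in> (facet_graph 3 M)\<^sup>*"
proof -
  have pure: "pure_complex 3 M" and ridge: "\<forall>\<tau>\<in>faces 2 M. card {\<sigma> \<in> faces 3 M. \<tau> \<subseteq> \<sigma>} = 2"
    and conn: "\<forall>\<sigma>\<in>faces 3 M. \<forall>\<tau>\<in>faces 3 M. (\<sigma>, \<tau>) \<in> (facet_graph 3 M)\<^sup>*"
    using assms by (simp_all add: pseudomanifold_def weak_pseudomanifold_def)
  have sc: "simplicial_complex M" and dim: "has_dimension 3 M"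
    and ex: "\<forall>\<sigma>\<in>M. \<exists>\<tau>\<in>faces 3 M. \<sigma> \<subseteq> \<tau>"
    using pure by (simp_all add: pure_complex_def)
  show "finite M" "{} \<notin> M" using sc by (auto simp: simplicial_complex_def)
  show "finite \<sigma>" if "\<sigma> \<in> M" for \<sigma> using sc that by (simp add: simplicial_complex_def)
  show "\<tau> \<in> M" if "\<sigma> \<in> M" "\<tau> \<subseteq> \<sigma>" "\<tau> \<noteq> {}" for \<sigma> \<tau>
    using sc that unfolding simplicial_complex_def by blast
  show "card \<sigma> \<le> 4" if "\<sigma> \<in> M" for \<sigma> using dim that by (simp add: has_dimension_def)
  show "\<exists>\<tau>\<in>faces 3 M. \<sigma> \<subseteq> \<tau>" if "\<sigma> \<in> M" for \<sigma> using ex that by blast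
  show "card {\<sigma> \<in> faces 3 M. \<tau> \<subseteq> \<sigma>} = 2" if "\<tau> \<in> faces 2 M" for \<tau> using ridge that by blast
  show "(\<sigma>, \<tau>) \<in> (facet_graph 3 M)\<^sup>*" if "\<sigma> \<in> faces 3 M" "\<tau> \<in> faces 3 M" for \<sigma> \<tau>
    using conn that by blast
qed

lemma sym_facet_graph: "sym (facet_graph d K)"
  by (auto simp: sym_def facet_graph_def Int_commute)

lemma faces2_if_faces3:
  assumes M: "pseudomanifold 3 M" and s: "\<sigma> \<in> faces 3 M" "T \<subseteq> \<sigma>" "card T = 3"
  shows "T \<in> faces 2 M"
  using s pseudomanifoldD(4)[OF M, of \<sigma> T] by (cases "T = {}") (auto simp: faces_def)

lemma facets_of_two_face:
  assumes M: "pseudomanifold 3 M" and pq: "p \<noteq> q"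
    and T: "card T = 3" "p \<notin> T" "q \<notin> T" "insert p T \<in> faces 3 M" "insert q T \<in> faces 3 M"
  shows "{\<sigma> \<in> faces 3 M. T \<subseteq> \<sigma>} = {insert p T, insert q T}"
proof (rule card_seteq[symmetric])
  have T2: "T \<in> faces 2 M" using faces2_if_faces3[OF M T(4)] T(1) by auto
  moreover have ne: "insert p T \<noteq> insert q T" using pq T by blast
  ultimately show "card {\<sigma> \<in> faces 3 M. T \<subseteq> \<sigma>} \<le> card {insert p T, insert q T}"
    using pseudomanifoldD(7)[OF M T2] ne by simp
  show "finite {\<sigma> \<in> faces 3 M. T \<subseteq> \<sigma>}" using pseudomanifoldD(1)[OF M] by (auto simp: faces_def)
  show "{insert p T, insert q T} \<subseteq> {\<sigma> \<in> faces 3 M. T \<subseteq> \<sigma>}" using T by blast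
qed

text \<open>The dimension bound leaves only singletons in the link of a triangle, and the two-facet
  condition leaves only \<open>p\<close> and \<open>q\<close>. Any pair of adjacent facets thus
  becomes a candidate for a move.\<close>

lemma link_of_two_face:
  assumes M: "pseudomanifold 3 M" and pq: "p \<noteq> q"
    and T: "card T = 3" "p \<notin> T" "q \<notin> T" "insert p T \<in> faces 3 M" "insert q T \<in> faces 3 M"
  shows "link M T = {{p}, {q}}"
proof
  have fT: "finite T" using T(1) card.infinite by fastforce
  show "link M T \<subseteq> {{p}, {q}}"
  proof
    fix \<tau> assume t: "\<tau> \<in> link M T"
    then have tM: "\<tau> \<in> M" "\<tau> \<inter> T = {}" "\<tau> \<union> T \<in> M" by (auto simp: link_def)
    have fin: "finite \<tau>" and "\<tau> \<noteq> {}" using tM pseudomanifoldD(2,3)[OF M] by auto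
    have "card (\<tau> \<union> T) \<le> 4" using pseudomanifoldD(5)[OF M tM(3)] .
    then have "card \<tau> \<le> 1" using card_Un_disjoint[OF fin fT tM(2)] T(1) by linarith
    moreover have "card \<tau> \<noteq> 0" using fin \<open>\<tau> \<noteq> {}\<close> by simp
    ultimately have "card \<tau> = 1" by linarith
    then obtain z where z: "\<tau> = {z}" by (auto simp: card_1_singleton_iff)
    then have "insert z T \<in> M" "z \<notin> T" using tM by auto
    then have "insert z T \<in> faces 3 M" using T(1) fT by (simp add: faces_def)
    then have "insert z T \<in> {\<sigma> \<in> faces 3 M. T \<subseteq> \<sigma>}" by (simp add: subset_insertI)
    then have "insert z T = insert p T \<or> insert z T = insert q T"
      unfolding facets_of_two_face[OF assms] by simp
    then have "z = p \<or> z = q" using \<open>z \<notin> T\<close> by (metis insertE insertI1)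
    then show "\<tau> \<in> {{p}, {q}}" using z by blast
  qed
  have "insert p T \<in> M" "insert q T \<in> M" using T(4,5) by (simp_all add: faces_def)
  moreover from this have "{p} \<in> M" "{q} \<in> M"
    using pseudomanifoldD(4)[OF M, of "insert p T" "{p}"] pseudomanifoldD(4)[OF M, of "insert q T" "{q}"]
    by blast+
  ultimately show "{{p}, {q}} \<subseteq> link M T"
    using T(2,3) by (simp add: link_def)
qed

section \<open>Effect of a single bistellar 1-move\<close>

locale bistellar1 =
  fixes M :: "'a set set" and A x y
  assumes M: "pseudomanifold 3 M" and A: "A \<in> faces 2 M" and xy: "x \<noteq> y"
    and link_A: "link M A = {{x}, {y}}" and nonedge: "{x, y} \<notin> M"
begin

abbreviation "M' \<equiv> kappa A M"

text \<open>These are the three tetrahedra around the new edge; together they fill the bipyramid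
  formed by the two removed tetrahedra on \<open>A\<close>.\<close>

definition new_facet :: "'a \<Rightarrow> 'a set" where
  "new_facet v = {x, y} \<union> (A - {v})"

definition new_facets :: "'a set set" where
  "new_facets = {\<sigma> \<in> faces 3 M. \<not> A \<subseteq> \<sigma>} \<union> new_facet ` A"

lemma A_card: "card A = 3" "finite A" "A \<in> M"
  using A card.infinite[of A] by (auto simp: faces_def)

lemma xy_A: "x \<notin> A" "y \<notin> A"
proof -
  have "{x} \<in> link M A" "{y} \<in> link M A" using link_A by simp_all
  then show "x \<notin> A" "y \<notin> A" by (simp_all add: link_def)
qed

lemma A_facets: "insert x A \<in> faces 3 M" "insert y A \<in> faces 3 M"
proof -
  have "{x} \<in> link M A" "{y} \<in> link M A" using link_A by simp_all
  then have "{x} \<union> A \<in> M" "{y} \<union> A \<in> M" by (simp_all add: link_def)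
  then show "insert x A \<in> faces 3 M" "insert y A \<in> faces 3 M"
    using xy_A A_card by (auto simp: faces_def)
qed

lemma facet_over_A: "\<sigma> \<in> faces 3 M \<Longrightarrow> A \<subseteq> \<sigma> \<Longrightarrow> \<sigma> = insert x A \<or> \<sigma> = insert y A"
proof -
  assume "\<sigma> \<in> faces 3 M" "A \<subseteq> \<sigma>"
  then have "\<sigma> \<in> {\<sigma> \<in> faces 3 M. A \<subseteq> \<sigma>}" by simp
  then show ?thesis unfolding facets_of_two_face[OF M xy A_card(1) xy_A A_facets] by simp
qed

lemma not_both: "\<sigma> \<in> M \<Longrightarrow> x \<in> \<sigma> \<Longrightarrow> y \<notin> \<sigma>"
  using pseudomanifoldD(4)[OF M, of \<sigma> "{x, y}"] nonedge by auto

lemma new_facet_card: "v \<in> A \<Longrightarrow> card (new_facet v) = 4" "finite (new_facet v)"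
  using A_card xy_A xy by (auto simp: new_facet_def card_insert_if)

lemma inj_new_facet: "inj_on new_facet A"
  using xy_A by (auto simp: inj_on_def new_facet_def)

lemma new_facet_notin: "new_facet v \<notin> M"
  using not_both[of "new_facet v"] by (auto simp: new_facet_def)

lemma kappa_eq: "M' = complex_of_facets new_facets"
proof -
  have "\<Union> (link M A) = {x, y}" using link_A by auto
  then show ?thesis
    by (simp add: kappa_def new_facets_def new_facet_def image_def Setcompr_eq_image)
qed

lemma new_facets_card: "\<sigma> \<in> new_facets \<Longrightarrow> card \<sigma> = 4" "\<sigma> \<in> new_facets \<Longrightarrow> finite \<sigma>"
  using new_facet_card pseudomanifoldD(2)[OF M] by (auto simp: new_facets_def faces_def)

lemma finite_new_facets: "finite new_facets"
  using pseudomanifoldD(1)[OF M] A_card by (auto simp: new_facets_def faces_def)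

lemma faces3_kappa: "faces 3 M' = new_facets"
proof
  show "new_facets \<subseteq> faces 3 M'"
    using new_facets_card by (fastforce simp: kappa_eq complex_of_facets_def faces_def)
  show "faces 3 M' \<subseteq> new_facets"
  proof
    fix \<sigma> assume "\<sigma> \<in> faces 3 M'"
    then obtain \<tau> where "\<tau> \<in> new_facets" "\<sigma> \<subseteq> \<tau>" "card \<sigma> = 4"
      by (auto simp: kappa_eq complex_of_facets_def faces_def)
    then have "\<sigma> = \<tau>" using new_facets_card[of \<tau>] by (metis card_subset_eq)
    then show "\<sigma> \<in> new_facets" using \<open>\<tau> \<in> new_facets\<close> by simp
  qed
qed

lemma in_kappa_iff: "\<tau> \<in> M' \<longleftrightarrow> \<tau> \<noteq> {} \<and> (\<exists>\<sigma>\<in>new_facets. \<tau> \<subseteq> \<sigma>)"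
  by (simp add: kappa_eq complex_of_facets_def)

text \<open>Only the two tetrahedra on \<open>A\<close> disappear, and a face of one of them that
  misses some \<open>v\<close> in \<open>A\<close> lies in \<open>new_facet v\<close>.\<close>

lemma kappa_retains:
  assumes "\<tau> \<in> M" "\<not> A \<subseteq> \<tau>"
  shows "\<tau> \<in> M'"
proof -
  obtain \<sigma> where s: "\<sigma> \<in> faces 3 M" "\<tau> \<subseteq> \<sigma>" using pseudomanifoldD(6)[OF M assms(1)] by auto
  have "\<tau> \<noteq> {}" using assms pseudomanifoldD(3)[OF M] by auto
  show ?thesis
  proof (cases "A \<subseteq> \<sigma>")
    case False
    then show ?thesis using s \<open>\<tau> \<noteq> {}\<close> by (auto simp: in_kappa_iff new_facets_def)
  next
    case True
    then have "\<sigma> = insert x A \<or> \<sigma> = insert y A" using s facet_over_A by blast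
    moreover obtain v where "v \<in> A" "v \<notin> \<tau>" using assms by auto
    ultimately have "\<tau> \<subseteq> new_facet v" using s by (auto simp: new_facet_def)
    then show ?thesis using \<open>\<tau> \<noteq> {}\<close> \<open>v \<in> A\<close> by (auto simp: in_kappa_iff new_facets_def)
  qed
qed

lemma new_edge: "{x, y} \<in> M'"
proof -
  obtain v where "v \<in> A" using A_card(1) by fastforce
  then show ?thesis by (auto simp: in_kappa_iff new_facets_def new_facet_def)
qed

lemma vertices_kappa: "vertices M' = vertices M"
proof
  have "\<not> A \<subseteq> {v}" for v
    using card_mono[of "{v}" A] A_card by auto
  then show "vertices M \<subseteq> vertices M'"
    using kappa_retains by (auto simp: vertices_def)
  show "vertices M' \<subseteq> vertices M"
  proof
    fix v assume "v \<in> vertices M'"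
    then obtain \<sigma> where s: "\<sigma> \<in> new_facets" "v \<in> \<sigma>" by (auto simp: vertices_def in_kappa_iff)
    have "\<exists>\<rho>\<in>M. v \<in> \<rho>"
    proof (cases "\<sigma> \<in> M")
      case False
      then have "v \<in> insert x A \<or> v \<in> insert y A"
        using s by (auto simp: new_facets_def new_facet_def faces_def)
      moreover have "insert x A \<in> M" "insert y A \<in> M" using A_facets by (simp_all add: faces_def)
      ultimately show ?thesis by blast
    qed (use s in blast)
    then obtain \<rho> where "\<rho> \<in> M" "v \<in> \<rho>" by blast
    then show "v \<in> vertices M" using pseudomanifoldD(4)[OF M, of \<rho> "{v}"] by (simp add: vertices_def)
  qed
qed

text \<open>These are the boundary triangles of the bipyramid with apex \<open>p\<close>, along
  which both the removed and the new tetrahedra are glued to the rest.\<close>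

lemma two_face_in_one_endpoint:
  assumes "p \<in> {x, y}" "\<tau> \<subseteq> insert p A" "card \<tau> = 3" "\<tau> \<noteq> A"
  obtains v where "v \<in> A" "\<tau> = insert p (A - {v})"
proof -
  have fin: "finite \<tau>" using assms A_card finite_subset by (metis finite_insert)
  have "p \<in> \<tau>" using assms card_subset_eq[OF A_card(2), of \<tau>] A_card by auto
  have "card (insert p A - \<tau>) = 1"
    using assms A_card xy_A fin by (auto simp: card_Diff_subset)
  then obtain v where v: "insert p A - \<tau> = {v}" by (auto simp: card_1_singleton_iff)
  then have "\<tau> = insert p A - {v}" using assms by auto
  moreover have "v \<noteq> p" "v \<in> A" using v \<open>p \<in> \<tau>\<close> by auto
  ultimately show ?thesis using that[of v] by auto
qed

text \<open>Triangles are of three kinds. One containing the new edge lies in exactly two new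
  tetrahedra. One on the boundary of the bipyramid loses a removed tetrahedron and gains a new one.
  Any other keeps its two facets.\<close>

lemma ridge_kappa:
  assumes t: "\<tau> \<in> faces 2 M'"
  shows "card {\<sigma> \<in> new_facets. \<tau> \<subseteq> \<sigma>} = 2"
proof -
  obtain \<sigma> where s: "\<sigma> \<in> new_facets" "\<tau> \<subseteq> \<sigma>" and c: "card \<tau> = 3"
    using t by (auto simp: faces_def in_kappa_iff)
  have fin: "finite \<tau>" using s new_facets_card finite_subset by metis
  have ne: "\<tau> \<noteq> {}" using c by auto
  have nA: "\<tau> \<noteq> A" using s xy_A by (auto simp: new_facets_def new_facet_def)
  show ?thesis
  proof (cases "x \<in> \<tau> \<and> y \<in> \<tau>")
    case True
    then have "card (\<tau> - {x, y}) = 1" using c xy fin by (simp add: card_Diff_subset)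
    then obtain a where a: "\<tau> - {x, y} = {a}" by (auto simp: card_1_singleton_iff)
    then have ta: "\<tau> = {x, y, a}" "a \<noteq> x" "a \<noteq> y" using True by auto
    have nM: "\<not> \<tau> \<subseteq> \<rho>" if "\<rho> \<in> M" for \<rho> using that not_both True by auto
    then have aA: "a \<in> A" using s ta by (auto simp: new_facets_def new_facet_def faces_def)
    \<comment> \<open>The third vertex \<open>a\<close> must not be the omitted one, which leaves
      two of the three new tetrahedra.\<close>
    have "{\<sigma> \<in> new_facets. \<tau> \<subseteq> \<sigma>} = new_facet ` (A - {a})"
      using nM ta aA by (auto simp: new_facets_def new_facet_def faces_def)
    also have "card \<dots> = 2"
      using card_image[OF inj_on_subset[OF inj_new_facet, of "A - {a}"]] aA A_card by simp
    finally show ?thesis .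
  next
    case False
    note nxy = False
    have subs: "\<exists>p\<in>{x, y}. \<tau> \<subseteq> insert p A" if "\<tau> \<subseteq> new_facet v" "v \<in> A" for v
      using nxy that by (auto simp: new_facet_def)
    have tM: "\<tau> \<in> M"
    proof (cases "\<sigma> \<in> M")
      case True
      then show ?thesis using pseudomanifoldD(4)[OF M _ s(2) ne] by simp
    next
      case False
      then obtain v where "v \<in> A" "\<sigma> = new_facet v" using s by (auto simp: new_facets_def faces_def)
      then obtain p where "p \<in> {x, y}" "\<tau> \<subseteq> insert p A" using s subs by blast
      then show ?thesis using pseudomanifoldD(4)[OF M, of "insert p A" \<tau>] A_facets ne
        by (auto simp: faces_def)
    qed
    then have two: "card {\<sigma> \<in> faces 3 M. \<tau> \<subseteq> \<sigma>} = 2"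
      using pseudomanifoldD(7)[OF M] c by (auto simp: faces_def)
    show ?thesis
    proof (cases "\<exists>p\<in>{x, y}. \<tau> \<subseteq> insert p A")
      case True
      then obtain p where p: "p \<in> {x, y}" "\<tau> \<subseteq> insert p A" by auto
      then obtain v where v: "v \<in> A" "\<tau> = insert p (A - {v})"
        using two_face_in_one_endpoint c nA by metis
      \<comment> \<open>A triangle through the apex \<open>p\<close> lies in only one of the two
        removed tetrahedra, so exactly one old facet is lost.\<close>
      have old: "{\<sigma> \<in> faces 3 M. \<not> A \<subseteq> \<sigma> \<and> \<tau> \<subseteq> \<sigma>} = {\<sigma> \<in> faces 3 M. \<tau> \<subseteq> \<sigma>} - {insert p A}"
      proof -
        have "\<sigma> = insert p A" if "\<sigma> \<in> faces 3 M" "A \<subseteq> \<sigma>" "\<tau> \<subseteq> \<sigma>" for \<sigma>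
        proof -
          have "\<sigma> = insert x A \<or> \<sigma> = insert y A" using that facet_over_A by blast
          then show ?thesis using that v p xy xy_A by auto
        qed
        then show ?thesis by auto
      qed
      have new: "{\<sigma> \<in> new_facet ` A. \<tau> \<subseteq> \<sigma>} = {new_facet v}"
        using v p xy_A by (auto simp: new_facet_def)
      have "{\<sigma> \<in> new_facets. \<tau> \<subseteq> \<sigma>}
          = {\<sigma> \<in> faces 3 M. \<not> A \<subseteq> \<sigma> \<and> \<tau> \<subseteq> \<sigma>} \<union> {\<sigma> \<in> new_facet ` A. \<tau> \<subseteq> \<sigma>}"
        by (auto simp: new_facets_def)
      also have "\<dots> = insert (new_facet v) ({\<sigma> \<in> faces 3 M. \<tau> \<subseteq> \<sigma>} - {insert p A})"
        by (simp add: old new)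
      also have "card \<dots> = 2"
      proof -
        have "insert p A \<in> {\<sigma> \<in> faces 3 M. \<tau> \<subseteq> \<sigma>}" using p A_facets by auto
        moreover have "new_facet v \<notin> {\<sigma> \<in> faces 3 M. \<tau> \<subseteq> \<sigma>}"
          using new_facet_notin by (auto simp: faces_def)
        moreover have "finite {\<sigma> \<in> faces 3 M. \<tau> \<subseteq> \<sigma>}" using two by (intro card_ge_0_finite) simp
        ultimately show ?thesis using two by (simp only: card_insert_if finite_Diff Diff_iff card_Diff_singleton) simp
      qed
      finally show ?thesis .
    next
      case False
      then have "\<not> A \<subseteq> \<rho>" if "\<rho> \<in> faces 3 M" "\<tau> \<subseteq> \<rho>" for \<rho>
        using that facet_over_A by blast
      then have "{\<sigma> \<in> new_facets. \<tau> \<subseteq> \<sigma>} = {\<sigma> \<in> faces 3 M. \<tau> \<subseteq> \<sigma>}"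
        using False subs by (auto simp: new_facets_def)
      then show ?thesis using two by simp
    qed
  qed
qed

section \<open>Strong connectedness after a move\<close>

lemma adjacent_kappa:
  assumes "\<sigma> \<in> new_facets" "\<tau> \<in> new_facets" "card (\<sigma> \<inter> \<tau>) = 3"
  shows "(\<sigma>, \<tau>) \<in> facet_graph 3 M'"
  using assms by (fastforce simp: facet_graph_def faces3_kappa faces_def[of 2] in_kappa_iff)

lemma new_facets_connected:
  assumes "v \<in> A" "w \<in> A"
  shows "(new_facet v, new_facet w) \<in> (facet_graph 3 M')\<^sup>*"
proof (cases "v = w")
  case False
  have "new_facet v \<inter> new_facet w = insert x (insert y (A - {v, w}))"
    by (auto simp: new_facet_def)
  also have "card \<dots> = 3" using assms False A_card xy_A xy by (simp add: card_Diff_subset)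
  finally show ?thesis using assms adjacent_kappa[of "new_facet v" "new_facet w"]
    by (auto simp: new_facets_def)
qed simp

text \<open>The wall between a removed tetrahedron and a surviving one is a boundary triangle
  \<open>insert p (A - {v})\<close>, which is also a face of \<open>new_facet v\<close>.\<close>

lemma old_new_adjacent:
  assumes s: "\<sigma> \<in> faces 3 M" "A \<subseteq> \<sigma>" and t: "\<tau> \<in> faces 3 M" "\<not> A \<subseteq> \<tau>" and c: "card (\<sigma> \<inter> \<tau>) = 3"
  shows "\<exists>v\<in>A. (new_facet v, \<tau>) \<in> facet_graph 3 M'"
proof -
  obtain p where p: "p \<in> {x, y}" "\<sigma> = insert p A" using s facet_over_A by blast
  have "\<sigma> \<inter> \<tau> \<noteq> A" using t by auto
  then obtain v where v: "v \<in> A" "\<sigma> \<inter> \<tau> = insert p (A - {v})"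
    using two_face_in_one_endpoint[OF p(1), of "\<sigma> \<inter> \<tau>"] p c by auto
  have "\<tau> \<in> M" using t by (auto simp: faces_def)
  then have "\<not> (x \<in> \<tau> \<and> y \<in> \<tau>)" using not_both by auto
  then have "new_facet v \<inter> \<tau> = insert p (A - {v})"
    using v p by (auto simp: new_facet_def)
  then have "card (new_facet v \<inter> \<tau>) = 3" using v c by simp
  then show ?thesis using adjacent_kappa[of "new_facet v" \<tau>] v t by (auto simp: new_facets_def)
qed

text \<open>Facet paths of \<open>M\<close> are carried over by a map that sends both removed
  tetrahedra to one fixed new tetrahedron and fixes all other facets; consecutive images stay
  connected.\<close>

lemma kappa_connected:
  assumes "\<sigma> \<in> new_facets" "\<tau> \<in> new_facets"
  shows "(\<sigma>, \<tau>) \<in> (facet_graph 3 M')\<^sup>*"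
proof -
  define R where "R = (facet_graph 3 M')\<^sup>*"
  have symR: "(b, a) \<in> R" if "(a, b) \<in> R" for a b
    using that sym_rtrancl[OF sym_facet_graph] unfolding R_def sym_def by blast
  have transR: "(a, c) \<in> R" if "(a, b) \<in> R" "(b, c) \<in> R" for a b c
    using that unfolding R_def by auto
  obtain v0 where v0: "v0 \<in> A" using A_card(1) by fastforce
  \<comment> \<open>The choice of \<open>v0\<close> is immaterial because distinct new tetrahedra
    are adjacent to each other.\<close>
  define \<pi> where "\<pi> \<sigma> = (if A \<subseteq> \<sigma> then new_facet v0 else \<sigma>)" for \<sigma>
  have one: "(\<pi> \<sigma>, \<pi> \<tau>) \<in> R" if st: "\<sigma> \<in> faces 3 M" "A \<subseteq> \<sigma>" "\<tau> \<in> faces 3 M" "\<not> A \<subseteq> \<tau>" "card (\<sigma> \<inter> \<tau>) = 3"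
    for \<sigma> \<tau>
  proof -
    obtain v where "v \<in> A" "(new_facet v, \<tau>) \<in> facet_graph 3 M'" using old_new_adjacent[OF st] by auto
    then show ?thesis using new_facets_connected[OF v0, of v] st by (auto simp: \<pi>_def R_def)
  qed
  have step: "(\<pi> \<sigma>, \<pi> \<tau>) \<in> R" if "(\<sigma>, \<tau>) \<in> facet_graph 3 M" for \<sigma> \<tau>
  proof -
    have st: "\<sigma> \<in> faces 3 M" "\<tau> \<in> faces 3 M" "card (\<sigma> \<inter> \<tau>) = 3"
      using that by (auto simp: facet_graph_def faces_def)
    show ?thesis
    proof (cases "A \<subseteq> \<sigma>"; cases "A \<subseteq> \<tau>")
      assume "\<not> A \<subseteq> \<sigma>" "\<not> A \<subseteq> \<tau>"
      then show ?thesis using st adjacent_kappa[of \<sigma> \<tau>] by (auto simp: \<pi>_def R_def new_facets_def)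
    next
      assume "\<not> A \<subseteq> \<sigma>" "A \<subseteq> \<tau>"
      then show ?thesis using one[of \<tau> \<sigma>] st symR by (auto simp: Int_commute)
    qed (use one st in \<open>auto simp: \<pi>_def R_def\<close>)
  qed
  have path: "(\<pi> \<sigma>, \<pi> \<tau>) \<in> R" if "(\<sigma>, \<tau>) \<in> (facet_graph 3 M)\<^sup>*" for \<sigma> \<tau>
    using that by (induction rule: rtrancl_induct) (use step transR in \<open>auto simp: R_def\<close>)
  \<comment> \<open>A new tetrahedron is joined to the image of the removed
    \<open>insert x A\<close>; an old facet is its own image.\<close>
  have lift: "\<exists>\<rho>\<in>faces 3 M. (\<sigma>, \<pi> \<rho>) \<in> R" if "\<sigma> \<in> new_facets" for \<sigma>
  proof (cases "\<sigma> \<in> new_facet ` A")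
    case True
    then show ?thesis using new_facets_connected[OF _ v0] A_facets
      by (intro bexI[of _ "insert x A"]) (auto simp: \<pi>_def R_def)
  next
    case False
    then show ?thesis using that
      by (intro bexI[of _ \<sigma>]) (auto simp: \<pi>_def R_def new_facets_def)
  qed
  obtain \<rho> where r: "\<rho> \<in> faces 3 M" "(\<sigma>, \<pi> \<rho>) \<in> R" using lift[OF assms(1)] by auto
  obtain \<rho>' where r': "\<rho>' \<in> faces 3 M" "(\<tau>, \<pi> \<rho>') \<in> R" using lift[OF assms(2)] by auto
  have "(\<pi> \<rho>, \<pi> \<rho>') \<in> R" using path pseudomanifoldD(8)[OF M r(1) r'(1)] by auto
  then show ?thesis using r r' symR transR unfolding R_def[symmetric] by blast
qed

lemma pseudomanifold_kappa: "pseudomanifold 3 M'"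
proof -
  have "M' \<subseteq> Pow (\<Union> new_facets)" using in_kappa_iff by blast
  moreover have "finite (\<Union> new_facets)" using finite_new_facets new_facets_card by auto
  ultimately have "finite M'" by (meson finite_Pow_iff finite_subset)
  moreover have "finite \<tau> \<and> \<tau> \<noteq> {} \<and> card \<tau> \<le> 4" if "\<tau> \<in> M'" for \<tau>
    using that new_facets_card card_mono finite_subset unfolding in_kappa_iff by metis
  moreover have "\<tau> \<in> M'" if "\<sigma> \<in> M'" "\<tau> \<subseteq> \<sigma>" "\<tau> \<noteq> {}" for \<sigma> \<tau>
    using that unfolding in_kappa_iff by blast
  ultimately have "simplicial_complex M'" "\<forall>\<tau>\<in>M'. card \<tau> \<le> 4"
    unfolding simplicial_complex_def by blast+
  moreover have "new_facets \<noteq> {}" using new_edge by (auto simp: in_kappa_iff)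
  ultimately show ?thesis
    unfolding pseudomanifold_def weak_pseudomanifold_def pure_complex_def has_dimension_def
    using ridge_kappa kappa_connected by (auto simp: faces3_kappa in_kappa_iff)
qed

end

section \<open>Stuck complexes with a missing edge\<close>

definition sublists_of_length :: "nat \<Rightarrow> nat list list" where
  "sublists_of_length k = filter (\<lambda>l. length l = k) (subseqs [0..<8])"

text \<open>\<open>insort\<close> keeps lists increasing, so each vertex set has a single list, and
  every potential facet a single atom \<open>F l\<close>, whichever triangle it is reached
  from.\<close>

definition extensions :: "nat list \<Rightarrow> nat list list" where
  "extensions t = map (\<lambda>d. insort d t) (filter (\<lambda>d. d \<notin> set t) [0..<8])"

text \<open>On concrete lists this recursion unfolds to propositional clauses instead of a
  cardinality. Its equations match on successors, hence the bound \<open>Suc (Suc 0)\<close> where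
  it is applied.\<close>

fun at_most :: "nat \<Rightarrow> ('a \<Rightarrow> bool) \<Rightarrow> 'a list \<Rightarrow> bool" where
  "at_most 0 P xs \<longleftrightarrow> (\<forall>x\<in>set xs. \<not> P x)" |
  "at_most (Suc n) P [] \<longleftrightarrow> True" |
  "at_most (Suc n) P (x # xs) \<longleftrightarrow> at_most (Suc n) P xs \<and> (P x \<longrightarrow> at_most n P xs)"

lemma at_most_if_length_filter: "length (filter P xs) \<le> n \<Longrightarrow> at_most n P xs"
  by (induction n P xs rule: at_most.induct) (auto split: if_splits simp: filter_empty_conv)

lemma sublists_of_lengthD:
  assumes "t \<in> set (sublists_of_length k)"
  shows "distinct t" "set t \<subseteq> {..<8}" "length t = k"
proof -
  have t: "t \<in> set (subseqs [0..<8])" "length t = k"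
    using assms unfolding sublists_of_length_def by auto
  then have "set t \<in> set ` set (subseqs [0..<8])" by blast
  then show "set t \<subseteq> {..<8}" by (auto simp: subseqs_powset)
  show "distinct t" using t subseqs_distinctD by fastforce
  show "length t = k" using t by simp
qed

lemma sublists_of_length_exists:
  assumes "S \<subseteq> {..<8}" "card S = k"
  shows "\<exists>t\<in>set (sublists_of_length k). set t = S"
proof -
  have "S \<in> set ` set (subseqs [0..<8])" using assms by (auto simp: subseqs_powset)
  then obtain t where t: "t \<in> set (subseqs [0..<8])" "set t = S" by auto
  have "distinct t" using t subseqs_distinctD by fastforce
  then have "length t = k" using t assms distinct_card by fastforce
  then show ?thesis using t unfolding sublists_of_length_def by auto
qed

lemma upt_0_8: "[0..<8] = [0,1,2,3,4,5,6,7]"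
  by (simp add: upt_conv_Cons)

section \<open>Propositional constraints on a stuck complex\<close>

text \<open>
A sorted list of four numbers below 8 encodes a potential facet, with 0 and 1 in the roles of
\<open>x\<close> and \<open>y\<close>. For concrete numerals the simplifier turns the assumptions into propositional clauses
over the atoms \<open>F l\<close>.
\<close>

locale facet_pattern =
  fixes F :: "nat list \<Rightarrow> bool"
  assumes other: "\<forall>t\<in>set (sublists_of_length 3). \<forall>l\<in>set (extensions t).
      F l \<longrightarrow> (\<exists>l'\<in>set (extensions t). l' \<noteq> l \<and> F l')"
    and at_most_two: "\<forall>t\<in>set (sublists_of_length 3). at_most (Suc (Suc 0)) F (extensions t)"
    and nonedge: "\<forall>l\<in>set (sublists_of_length 4). 0 \<in> set l \<and> 1 \<in> set l \<longrightarrow> \<not> F l"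
    and stuck: "\<forall>t\<in>set (sublists_of_length 3). \<forall>d\<in>{0,1}. \<forall>e\<in>set [0..<8].
      d \<noteq> e \<and> d \<notin> set t \<and> e \<notin> set t \<and> F (insort d t) \<and> F (insort e t) \<longrightarrow>
      (\<exists>l\<in>set (sublists_of_length 4). d \<in> set l \<and> e \<in> set l \<and> F l)"
    and covered: "\<exists>l\<in>set (sublists_of_length 4). 1 \<in> set l \<and> F l"
begin

text \<open>Without \<open>One_nat_def\<close> the entry \<open>1\<close> does not become
  \<open>Suc 0\<close>, so the atoms agree with the lists in the pattern lemmas.\<close>

context
  notes sublists_of_length_def [simp] extensions_def [simp] upt_0_8 [simp]
    Let_def [simp] One_nat_def [simp del]
begin

text \<open>Rewriting with these clauses removes the 15 lists containing both 0 and 1 from all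
  others, which leaves 55 atoms.\<close>

lemmas nonedge_clauses = nonedge [simplified]
lemmas other_clauses = other [simplified, simplified nonedge_clauses simp_thms]
lemmas at_most_two_clauses = at_most_two [simplified, simplified nonedge_clauses simp_thms]
lemmas stuck_clauses = stuck [simplified, simplified nonedge_clauses simp_thms]
lemmas covered_clauses = covered [simplified, simplified nonedge_clauses simp_thms]

end

text \<open>Any two triangles of a tetrahedron share an edge, so up to renumbering this is the
  general case of a facet with distinct triangles in the links of 0 and 1. The clauses exclude it by
  a propositional refutation.\<close>

lemma pattern_both_links: "\<not> (F [0,2,4,5] \<and> F [2,3,4,5] \<and> F [1,3,4,5])"
  using other_clauses at_most_two_clauses stuck_clauses nonedge_clauses covered_clauses by (smt (verit))

text \<open>The shared triangle 234 is absent from the conclusion because \<open>[0,2,3,4]\<close>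
  would be a third facet on it. What remains are the triangles through 6 of the second facet; that
  one of them is in the link of 0 follows by propositional refutation.\<close>

lemma pattern_propagation:
  "F [0,2,3,5] \<Longrightarrow> F [2,3,4,5] \<Longrightarrow> F [2,3,4,6] \<Longrightarrow> F [0,2,3,6] \<or> F [0,2,4,6] \<or> F [0,3,4,6]"
  using other_clauses at_most_two_clauses stuck_clauses nonedge_clauses covered_clauses by (smt (verit))

end

section \<open>From a stuck complex to the pattern\<close>

locale stuck_nonedge =
  fixes M :: "'a set set" and x y
  assumes M: "pseudomanifold 3 M" and card8: "card (vertices M) = 8"
    and none: "\<And>A. \<not> bistellar1_admissible A M"
    and x: "x \<in> vertices M" and y: "y \<in> vertices M" and xy: "x \<noteq> y" and nonedge: "{x, y} \<notin> M"
begin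

abbreviation "L \<equiv> faces 3 M"

text \<open>The link of \<open>T\<close> is \<open>{{p}, {q}}\<close>, so a missing edge
  \<open>{p, q}\<close> would make \<open>T\<close> admissible.\<close>

lemma stuck:
  assumes "p \<noteq> q" "card T = 3" "p \<notin> T" "q \<notin> T" "insert p T \<in> L" "insert q T \<in> L"
  shows "{p, q} \<in> M"
proof -
  have "T \<in> faces 2 M" using faces2_if_faces3[OF M assms(5)] assms(2) by auto
  then show ?thesis
    using none[of T] link_of_two_face[OF M assms] assms(1) by (auto simp: bistellar1_admissible_def)
qed

lemma not_both: "\<sigma> \<in> M \<Longrightarrow> x \<in> \<sigma> \<Longrightarrow> y \<notin> \<sigma>"
  using pseudomanifoldD(4)[OF M, of \<sigma> "{x, y}"] nonedge by auto

lemma in_vertices: "\<sigma> \<in> M \<Longrightarrow> \<sigma> \<subseteq> vertices M"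
  using pseudomanifoldD(4)[OF M] by (auto simp: vertices_def)

text \<open>\<open>T\<close> ranges over all triples, as in the pattern; a triple that is not a face
  of \<open>M\<close> lies in no facet.\<close>

lemma card_facets_le:
  assumes "card T = 3" shows "card {\<sigma> \<in> L. T \<subseteq> \<sigma>} \<le> 2"
proof (cases "T \<in> faces 2 M")
  case False
  then have "{\<sigma> \<in> L. T \<subseteq> \<sigma>} = {}" using faces2_if_faces3[OF M _ _ assms] by auto
  then show ?thesis by (simp only: card.empty zero_le)
qed (use pseudomanifoldD(7)[OF M] in simp)

lemma other_facet:
  assumes "card T = 3" "p \<notin> T" "insert p T \<in> L"
  shows "\<exists>q. q \<noteq> p \<and> q \<notin> T \<and> q \<in> vertices M \<and> insert q T \<in> L"
proof -
  have "T \<in> faces 2 M" using faces2_if_faces3[OF M assms(3)] assms(1) by auto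
  then have "card {\<sigma> \<in> L. T \<subseteq> \<sigma>} = 2" using pseudomanifoldD(7)[OF M] by simp
  then have "\<not> {\<sigma> \<in> L. T \<subseteq> \<sigma>} \<subseteq> {insert p T}"
    using card_mono[of "{insert p T}" "{\<sigma> \<in> L. T \<subseteq> \<sigma>}"] by auto
  then obtain \<sigma> where s: "\<sigma> \<in> L" "T \<subseteq> \<sigma>" "\<sigma> \<noteq> insert p T" by auto
  have "finite T" using assms(1) card.infinite by fastforce
  then have "card (\<sigma> - T) = 1" using s assms(1) by (simp add: faces_def card_Diff_subset)
  then obtain q where "\<sigma> - T = {q}" by (auto simp: card_1_singleton_iff)
  then have "\<sigma> = insert q T" "q \<notin> T" using s by auto
  moreover have "q \<in> vertices M" using in_vertices[of \<sigma>] s \<open>\<sigma> = insert q T\<close> by (auto simp: faces_def)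
  ultimately show ?thesis using s by auto
qed

text \<open>The order of \<open>us\<close> is arbitrary, so the pattern lemmas, stated for fixed
  numerals, apply to any choice of vertices after a suitable enumeration.\<close>

lemma facet_pattern:
  assumes vs: "distinct (x # y # us)" "set (x # y # us) = vertices M"
  shows "facet_pattern (\<lambda>l. (!) (x # y # us) ` set l \<in> L)"
proof -
  define v where "v = (!) (x # y # us)"
  have v01: "v 0 = x" "v 1 = y" by (auto simp: v_def)
  have "length (x # y # us) = 8" using distinct_card[OF vs(1)] vs(2) card8 by simp
  then have bij: "bij_betw v {..<8} (vertices M)"
    using bij_betw_nth[OF vs(1), of "{..<8}"] vs(2) by (simp add: v_def del: set_simps)
  then have inj: "inj_on v {..<8}" by (simp add: bij_betw_def)
  have v_eq: "v i = v j \<longleftrightarrow> i = j" if "i < 8" "j < 8" for i j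
    using inj that by (auto simp: inj_on_def)
  have pre: "\<exists>i<8. v i = w" if "w \<in> vertices M" for w
    using bij that unfolding bij_betw_def by (metis imageE lessThan_iff)
  have notin: "v d \<notin> v ` set t" if "d < 8" "set t \<subseteq> {..<8}" "d \<notin> set t" for d t
    using that v_eq by (auto simp: subset_iff)
  have card3: "card (v ` set t) = 3" if "t \<in> set (sublists_of_length 3)" for t
    using sublists_of_lengthD[OF that] distinct_card[of t] inj
    by (metis card_image inj_on_subset)
  have ext: "\<exists>d<8. d \<notin> set t \<and> l = insort d t" if "l \<in> set (extensions t)" for l t
    using that by (auto simp: extensions_def)
  have ext': "insort d t \<in> set (extensions t)" if "d < 8" "d \<notin> set t" for d t
    using that by (auto simp: extensions_def)
  have lift: "\<exists>l\<in>set (sublists_of_length 4). v ` set l = \<sigma>" if s: "\<sigma> \<in> L" for \<sigma>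
  proof -
    define S where "S = {i \<in> {..<8}. v i \<in> \<sigma>}"
    have "\<sigma> \<subseteq> vertices M" using s in_vertices by (auto simp: faces_def)
    then have vS: "v ` S = \<sigma>" using pre by (fastforce simp: S_def)
    have "inj_on v S" by (rule inj_on_subset[OF inj]) (auto simp: S_def)
    then have "card S = 4" using card_image[of v S] vS s by (simp add: faces_def)
    then obtain l where "l \<in> set (sublists_of_length 4)" "set l = S"
      using sublists_of_length_exists[of S 4] by (auto simp: S_def)
    then show ?thesis using vS by blast
  qed
  let ?F = "\<lambda>l. v ` set l \<in> L"
  have "facet_pattern ?F"
  proof (unfold_locales; (intro ballI impI)?)
    fix t l assume t: "t \<in> set (sublists_of_length 3)" and l: "l \<in> set (extensions t)" "?F l"
    then obtain d where d: "d < 8" "d \<notin> set t" "l = insort d t" using ext by blast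
    obtain q where q: "q \<noteq> v d" "q \<notin> v ` set t" "q \<in> vertices M" "insert q (v ` set t) \<in> L"
      using other_facet[OF card3[OF t], of "v d"] notin[OF d(1) _ d(2)] sublists_of_lengthD[OF t] l d
      by (auto simp: set_insort_key)
    then obtain e where e: "e < 8" "v e = q" using pre by blast
    then have "e \<notin> set t" "e \<noteq> d" using q by auto
    moreover from this have "set (insort e t) \<noteq> set l" using d by (auto simp: set_insort_key)
    ultimately have "insort e t \<in> set (extensions t)" "insort e t \<noteq> l" "?F (insort e t)"
      using e q ext' by (auto simp: set_insort_key)
    then show "\<exists>l'\<in>set (extensions t). l' \<noteq> l \<and> ?F l'" by blast
  next
    fix t assume t: "t \<in> set (sublists_of_length 3)"
    note tD = sublists_of_lengthD[OF t]
    \<comment> \<open>Facets over the triple are counted by the index of their fourth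
      vertex.\<close>
    let ?ds = "filter (\<lambda>d. ?F (insort d t)) (filter (\<lambda>d. d \<notin> set t) [0..<8])"
    have "length (filter ?F (extensions t)) = length ?ds"
      by (simp add: extensions_def filter_map comp_def)
    also have "\<dots> = card (set ?ds)" by (rule distinct_card[symmetric]) simp
    also have "\<dots> \<le> card {\<sigma> \<in> L. v ` set t \<subseteq> \<sigma>}"
    proof (rule card_inj_on_le[where f = "\<lambda>d. insert (v d) (v ` set t)"])
      show "inj_on (\<lambda>d. insert (v d) (v ` set t)) (set ?ds)"
      proof (rule inj_onI)
        fix d e assume de: "d \<in> set ?ds" "e \<in> set ?ds" "insert (v d) (v ` set t) = insert (v e) (v ` set t)"
        then have "v d = v e" using notin[OF _ tD(2), of d] by auto
        then show "d = e" using v_eq de by auto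
      qed
      show "finite {\<sigma> \<in> L. v ` set t \<subseteq> \<sigma>}" using pseudomanifoldD(1)[OF M] by (auto simp: faces_def)
    qed (auto simp: set_insort_key)
    also have "\<dots> \<le> 2" using card_facets_le[OF card3[OF t]] .
    finally show "at_most (Suc (Suc 0)) ?F (extensions t)"
      by (intro at_most_if_length_filter) simp
  next
    fix l :: "nat list" assume "0 \<in> set l \<and> 1 \<in> set l"
    then have "x \<in> v ` set l" "y \<in> v ` set l" using v01 by force+
    then show "\<not> ?F l" using not_both by (auto simp: faces_def)
  next
    fix t and d e :: nat
    assume t: "t \<in> set (sublists_of_length 3)" and de: "d \<in> {0, 1}" "e \<in> set [0..<8]"
      and h: "d \<noteq> e \<and> d \<notin> set t \<and> e \<notin> set t \<and> ?F (insort d t) \<and> ?F (insort e t)"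
    note tD = sublists_of_lengthD[OF t]
    have lt: "d < 8" "e < 8" using de by auto
    have "{v d, v e} \<in> M"
      using stuck[of "v d" "v e" "v ` set t"] card3[OF t] h lt v_eq notin[OF _ tD(2)]
      by (auto simp: set_insort_key)
    \<comment> \<open>By purity an edge is witnessed by a facet containing both ends, which is how
      the pattern expresses edges.\<close>
    then obtain \<sigma> where s: "\<sigma> \<in> L" "{v d, v e} \<subseteq> \<sigma>" using pseudomanifoldD(6)[OF M] by blast
    then obtain l where l: "l \<in> set (sublists_of_length 4)" "v ` set l = \<sigma>" using lift by blast
    then have "d \<in> set l" "e \<in> set l"
      using s lt notin[OF _ sublists_of_lengthD(2)[OF l(1)]] by blast+
    then show "\<exists>l\<in>set (sublists_of_length 4). d \<in> set l \<and> e \<in> set l \<and> ?F l"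
      using s l by blast
  next
    obtain \<sigma> where s: "\<sigma> \<in> L" "y \<in> \<sigma>"
      using y pseudomanifoldD(6)[OF M, of "{y}"] by (auto simp: vertices_def)
    then obtain l where l: "l \<in> set (sublists_of_length 4)" "v ` set l = \<sigma>" using lift by blast
    then have "1 \<in> set l"
      using s v01 notin[OF _ sublists_of_lengthD(2)[OF l(1)], of 1] by auto
    then show "\<exists>l\<in>set (sublists_of_length 4). 1 \<in> set l \<and> ?F l" using s l by blast
  qed
  then show ?thesis by (simp add: v_def)
qed

text \<open>The vertices of a configuration take positions 2, 3, ... of the enumeration and so match
  the numerals of the pattern lemmas.\<close>

lemma enumerate:
  assumes "distinct (x # y # us)" "set us \<subseteq> vertices M"
  obtains ws where "distinct (x # y # us @ ws)" "set (x # y # us @ ws) = vertices M"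
proof -
  have fin: "finite (vertices M)" using card8 card.infinite by fastforce
  obtain ws where ws: "set ws = vertices M - set (x # y # us)" "distinct ws"
    using finite_distinct_list[of "vertices M - set (x # y # us)"] fin by auto
  have d: "distinct (x # y # us @ ws)" using assms ws by auto
  have s: "set (x # y # us @ ws) = vertices M" using assms ws x y by auto
  show ?thesis by (rule that[OF d s])
qed

lemma no_facet_meets_both_links:
  assumes d: "distinct [x, y, a, b, c, d]"
    and L: "{x, a, c, d} \<in> L" "{a, b, c, d} \<in> L" "{y, b, c, d} \<in> L"
  shows False
proof -
  have "set [a, b, c, d] \<subseteq> vertices M"
    using in_vertices[of "{a, b, c, d}"] L(2) by (simp add: faces_def)
  then obtain ws where ws: "distinct (x # y # [a,b,c,d] @ ws)" "set (x # y # [a,b,c,d] @ ws) = vertices M"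
    using enumerate[of "[a,b,c,d]"] d by auto
  interpret facet_pattern "\<lambda>l. (!) (x # y # [a,b,c,d] @ ws) ` set l \<in> L"
    by (rule facet_pattern[OF ws])
  show False using pattern_both_links L by (simp add: insert_commute)
qed

text \<open>With \<open>a\<close> to \<open>e\<close> at positions 2 to 6 this is
  \<open>pattern_propagation\<close>. It carries a link triangle across the common triangle
  \<open>{a, b, c}\<close>.\<close>

lemma link_triangle_propagates:
  assumes d: "distinct [x, y, a, b, c, d, e]"
    and L: "{x, a, b, d} \<in> L" "{a, b, c, d} \<in> L" "{a, b, c, e} \<in> L"
  shows "{x, a, b, e} \<in> L \<or> {x, a, c, e} \<in> L \<or> {x, b, c, e} \<in> L"
proof -
  have "set [a, b, c, d, e] \<subseteq> vertices M"
    using in_vertices[of "{a, b, c, d}"] in_vertices[of "{a, b, c, e}"] L(2,3) by (simp add: faces_def)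
  then obtain ws where ws: "distinct (x # y # [a,b,c,d,e] @ ws)" "set (x # y # [a,b,c,d,e] @ ws) = vertices M"
    using enumerate[of "[a,b,c,d,e]"] d by auto
  interpret facet_pattern "\<lambda>l. (!) (x # y # [a,b,c,d,e] @ ws) ` set l \<in> L"
    by (rule facet_pattern[OF ws])
  show ?thesis using pattern_propagation L by (simp add: insert_commute)
qed

text \<open>The facets at distance at most one from the star of \<open>x\<close> in the facet graph.\<close>

definition near_x :: "'a set \<Rightarrow> bool" where
  "near_x \<sigma> \<longleftrightarrow> x \<in> \<sigma> \<or> (\<exists>z\<in>\<sigma>. insert x (\<sigma> - {z}) \<in> L)"

section \<open>Spreading from the star of \<open>x\<close>\<close>

lemma near_x_avoids_y:
  assumes s: "\<sigma> \<in> L" and near: "near_x \<sigma>"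
  shows "y \<notin> \<sigma>"
proof
  assume y: "y \<in> \<sigma>"
  then have x: "x \<notin> \<sigma>" using not_both s by (auto simp: faces_def)
  then obtain z where z: "z \<in> \<sigma>" "insert x (\<sigma> - {z}) \<in> L" using near by (auto simp: near_x_def)
  \<comment> \<open>A facet through \<open>x\<close> avoids \<open>y\<close>, so the vertex
    exchanged for \<open>x\<close> is \<open>y\<close> itself. The two facets then meet in
    \<open>\<sigma> - {y}\<close>, and \<open>stuck\<close> makes \<open>{x, y}\<close> an
    edge.\<close>
  then have "z = y" using not_both y by (auto simp: faces_def)
  moreover have "card (\<sigma> - {y}) = 3" using s y by (simp add: faces_def)
  ultimately have "{x, y} \<in> M"
    using stuck[of x y "\<sigma> - {y}"] xy x y z s by (simp add: insert_absorb)
  then show False using nonedge by simp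
qed

text \<open>Across the common triangle \<open>T\<close> the vertex \<open>z\<close> is exchanged for
  \<open>w\<close>. If \<open>w\<close> is \<open>y\<close>, then \<open>\<sigma>\<close> would have
  triangles in both links; otherwise the link triangle of \<open>\<sigma>\<close> forces one in
  \<open>\<tau>\<close>.\<close>

lemma near_x_adjacent:
  assumes st: "(\<sigma>, \<tau>) \<in> facet_graph 3 M" and near: "near_x \<sigma>"
  shows "near_x \<tau>"
proof (rule ccontr)
  assume far: "\<not> near_x \<tau>"
  have s: "\<sigma> \<in> L" "card \<sigma> = 4" "finite \<sigma>" and t: "\<tau> \<in> L" "card \<tau> = 4" "finite \<tau>"
    and c: "card (\<sigma> \<inter> \<tau>) = 3"
    using st pseudomanifoldD(2)[OF M] by (auto simp: facet_graph_def faces_def)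
  have "card (\<sigma> - \<tau>) = 1" "card (\<tau> - \<sigma>) = 1"
    using c s t by (simp_all add: card_Diff_subset_Int Int_commute)
  then obtain z w where z: "\<sigma> - \<tau> = {z}" and w: "\<tau> - \<sigma> = {w}"
    by (auto simp: card_1_singleton_iff)
  define T where "T = \<sigma> \<inter> \<tau>"
  have sT: "\<sigma> = insert z T" "z \<notin> T" and tT: "\<tau> = insert w T" "w \<notin> T" and zw: "z \<noteq> w"
    using z w by (auto simp: T_def)
  have T3: "card T = 3" "finite T" using c s by (auto simp: T_def)
  have xt: "x \<notin> \<tau>" using far by (auto simp: near_x_def)
  \<comment> \<open>Exchanging \<open>w\<close> for \<open>x\<close> in \<open>\<tau>\<close> gives
    \<open>insert x T\<close>, which as a facet would make \<open>\<tau>\<close> near.\<close>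
  have no_xT: "insert x T \<notin> L"
    using far tT by (auto simp: near_x_def)
  then have xs: "x \<notin> \<sigma>" using s sT xt tT by auto
  have ys: "y \<notin> \<sigma>" using near_x_avoids_y s near by simp
  obtain u where u: "u \<in> \<sigma>" "insert x (\<sigma> - {u}) \<in> L" using near xs by (auto simp: near_x_def)
  \<comment> \<open>The link triangle of \<open>\<sigma>\<close> is not \<open>T\<close>, so it
    contains \<open>z\<close> and omits a vertex \<open>u\<close> of \<open>T\<close>.\<close>
  have uT: "u \<in> T" using u no_xT sT by auto
  then have "card (T - {u}) = 2" using T3 by simp
  then obtain a b where ab: "T - {u} = {a, b}" "a \<noteq> b" by (auto simp: card_2_iff)
  then have T: "T = {a, b, u}" using uT by auto
  have dis: "distinct [a, b, u, z]" "distinct [x, y, a, b, u, z]"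
    using ab sT T xs ys xy by auto
  have L1: "{x, a, b, z} \<in> L"
  proof -
    have "insert x (\<sigma> - {u}) = {x, a, b, z}" using sT T dis(1) by auto
    then show ?thesis using u by simp
  qed
  have L2: "{a, b, u, z} \<in> L" using s sT T by (simp add: insert_commute)
  show False
  proof (cases "w = y")
    case True
    then have "{y, a, b, u} \<in> L" using t tT T by (simp add: insert_commute)
    then show False
      using no_facet_meets_both_links[of z u a b] L1 L2 dis(2) by (auto simp: insert_commute)
  next
    case False
    have L3: "{a, b, u, w} \<in> L" using t tT T by (simp add: insert_commute)
    have "distinct [x, y, a, b, u, z, w]" using dis(2) False tT zw xt T by auto
    then have "{x, a, b, w} \<in> L \<or> {x, a, u, w} \<in> L \<or> {x, b, u, w} \<in> L"
      using link_triangle_propagates L1 L2 L3 by blast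
    moreover have "\<tau> - {u} = {a, b, w}" "\<tau> - {b} = {a, u, w}" "\<tau> - {a} = {b, u, w}"
      using \<open>distinct [x, y, a, b, u, z, w]\<close> tT T by auto
    ultimately have "\<exists>z\<in>\<tau>. insert x (\<tau> - {z}) \<in> L" using tT T by auto
    then show False using far by (simp add: near_x_def)
  qed
qed

text \<open>On a facet path from a facet at \<open>x\<close> to one at \<open>y\<close>,
  \<open>near_x\<close> holds at the start and passes along every step, yet it fails at the
  end.\<close>

lemma contradiction: False
proof -
  obtain \<sigma> where s: "\<sigma> \<in> L" "x \<in> \<sigma>"
    using x pseudomanifoldD(6)[OF M, of "{x}"] by (auto simp: vertices_def)
  obtain \<tau> where t: "\<tau> \<in> L" "y \<in> \<tau>"
    using y pseudomanifoldD(6)[OF M, of "{y}"] by (auto simp: vertices_def)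
  have "(\<sigma>, \<tau>) \<in> (facet_graph 3 M)\<^sup>*" using pseudomanifoldD(8)[OF M s(1) t(1)] .
  then have "near_x \<tau>"
    by (induction rule: rtrancl_induct) (use s near_x_adjacent in \<open>auto simp: near_x_def[of \<sigma>]\<close>)
  then show False using near_x_avoids_y t by simp
qed

end

section \<open>Induction on the number of missing edges\<close>

lemma neighbourly_if_no_bistellar1:
  assumes "pseudomanifold 3 M" "card (vertices M) = 8" "\<And>A. \<not> bistellar1_admissible A M"
  shows "neighbourly M"
proof (rule ccontr)
  assume "\<not> neighbourly M"
  then obtain x y where "stuck_nonedge M x y"
    using assms by (auto simp: neighbourly_def stuck_nonedge_def)
  then show False by (rule stuck_nonedge.contradiction)
qed

theorem theorem1:
  fixes M :: "'a set set"
  assumes "pseudomanifold 3 M" and "card (vertices M) = 8"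
  shows "\<exists>As. bistellar1_sequence As M \<and>
           pseudomanifold 3 (fold kappa As M) \<and> neighbourly (fold kappa As M)"
  using assms
\<comment> \<open>A move keeps the vertex set and all edges and adds \<open>{x, y}\<close>, so the
  number of missing edges drops.\<close>
proof (induction "card {e \<in> Pow (vertices M). card e = 2 \<and> e \<notin> M}" arbitrary: M rule: less_induct)
  case less
  show ?case
  proof (cases "\<exists>A. bistellar1_admissible A M")
    case False
    then have "neighbourly M" using neighbourly_if_no_bistellar1[OF less.prems] by blast
    then show ?thesis using less.prems(1) by (intro exI[of _ "[]"]) simp
  next
    case True
    then obtain A where adm: "bistellar1_admissible A M" by blast
    then obtain x y where "A \<in> faces 2 M" "x \<noteq> y" "link M A = {{x}, {y}}" "{x, y} \<notin> M"
      unfolding bistellar1_admissible_def by metis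
    then interpret bistellar1 M A x y using less.prems(1) by unfold_locales
    let ?N = "\<lambda>K. {e \<in> Pow (vertices K). card e = 2 \<and> e \<notin> K}"
    have "finite (vertices M)" using less.prems(2) by (intro card_ge_0_finite) simp
    then have fin: "finite (?N M)" by simp
    \<comment> \<open>A pair cannot contain the three-element \<open>A\<close>, so
      \<open>kappa_retains\<close> applies to every edge.\<close>
    have "\<not> A \<subseteq> e" if "card e = 2" for e
      using that card_mono[of e A] A_card(1) card_ge_0_finite[of e] by auto
    then have sub: "?N M' \<subseteq> ?N M" using kappa_retains vertices_kappa by blast
    have mem: "{x, y} \<in> ?N M"
    proof -
      have "insert x A \<in> M" "insert y A \<in> M" using A_facets by (simp_all add: faces_def)
      then have "{x} \<in> M" "{y} \<in> M"
        using pseudomanifoldD(4)[OF M, of "insert x A" "{x}"] pseudomanifoldD(4)[OF M, of "insert y A" "{y}"]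
        by blast+
      then show ?thesis using nonedge xy by (simp add: vertices_def)
    qed
    have nmem: "{x, y} \<notin> ?N M'" using new_edge by blast
    have "?N M' \<noteq> ?N M"
    proof
      assume "?N M' = ?N M"
      then show False using mem nmem by (simp only: not_True_eq_False)
    qed
    with sub have "?N M' \<subset> ?N M" by (rule psubsetI)
    then have decr: "card (?N M') < card (?N M)" by (rule psubset_card_mono[OF fin])
    have "card (vertices M') = 8" using less.prems(2) vertices_kappa by simp
    then obtain As where "bistellar1_sequence As M'" "pseudomanifold 3 (fold kappa As M')"
      "neighbourly (fold kappa As M')"
      using less.hyps[OF decr pseudomanifold_kappa] by blast
    then show ?thesis using adm by (intro exI[of _ "A # As"]) simp
  qed
qed

end
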